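(* Let $G=(V,E)$ be a finite, regular, connected graph with $V=\{1,\ldots,m\}$, let $\alpha=1$, and let $x(n)=(x_1(n),\ldots,x_m(n))$, $n\ge 0$, be the proportions of balls in the generalized Pólya urn process on $G$ with parameter $\alpha=1$ (defined in the context), for arbitrary initial numbers of balls $B_i(0)\ge 1$. (a) If $G$ is non-bipartite, then almost surely $x(n)$ converges to the uniform measure $(1/m,\ldots,1/m)$ as $n\to\infty$. (b) If $G$ is bipartite with bipartition $V=A\cup B$, then almost surely $x(n)$ converges to the set $\Omega$ as $n\to\infty$ (that is, the distance from $x(n)$ to $\Omega$ tends to $0$; equivalently, every accumulation point of $(x(n))_{n\ge0}$ lies in $\Omega$), where $\Omega$ is the subset of the closed simplex $\{x\in\mathbb{R}^m: x_i\ge 0,\ \sum_i x_i=1\}$ given by $$\Omega=\{(x_1,\ldots,x_m):\ \exists\, p,q\ge 0,\ p+q=2/m,\ \text{such that } x_i=p \text{ for } i\in A,\ x_i=q\text{ for } i\in B\}.$$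
   Context: Graphs are simple and undirected. Generalized Pólya urn process on $G$ with parameter $\alpha>0$: let $G=(V,E)$ be a finite connected graph with $V=\{1,\ldots,m\}$ and $|E|=N$. Each vertex $i$ carries a bin, initially with an integer number $B_i(0)\ge 1$ of balls. Let $\mathcal F_n$ be the sigma-algebra generated by the process up to step $n$. At step $n+1$, for each edge $\{i,j\}\in E$ exactly one ball is added, either to $i$ or to $j$; conditionally on $\mathcal F_n$, the ball is added to $i$ with probability $\frac{B_i(n)^\alpha}{B_i(n)^\alpha+B_j(n)^\alpha}$ (and to $j$ otherwise), and the choices for distinct edges are independent. $B_i(n)$ is the number of balls at vertex $i$ after step $n$. With $N_0=\sum_{i=1}^m B_i(0)$, the proportion of balls at $i$ after step $n$ is $x_i(n)=\frac{B_i(n)}{N_0+nN}$. *)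

theory Defs
  imports "HOL-Probability.Probability"
begin

text \<open>
  The vertices of a graph are all elements of a finite type, so that \<open>m = CARD('v)\<close> and
  vectors of proportions live in \<open>real ^ 'v\<close>; a graph is given by its set of edges.
\<close>

definition simple_graph :: "'v::finite set set \<Rightarrow> bool" where
  "simple_graph E \<longleftrightarrow> (\<forall>e\<in>E. card e = 2)"

definition connected_graph :: "'v::finite set set \<Rightarrow> bool" where
  "connected_graph E \<longleftrightarrow> (\<forall>u v. (u, v) \<in> {(i, j). {i, j} \<in> E}\<^sup>*)"

definition degree :: "'v::finite set set \<Rightarrow> 'v \<Rightarrow> nat" where
  "degree E v = card {e \<in> E. v \<in> e}"

definition regular_graph :: "'v::finite set set \<Rightarrow> bool" where
  "regular_graph E \<longleftrightarrow> (\<exists>d. \<forall>v. degree E v = d)"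

text \<open>One of the two parts may be empty, so the graph with a single vertex is bipartite.\<close>

definition bipartition :: "'v::finite set set \<Rightarrow> 'v set \<Rightarrow> 'v set \<Rightarrow> bool" where
  "bipartition E A B \<longleftrightarrow>
     A \<union> B = UNIV \<and> A \<inter> B = {} \<and> (\<forall>e\<in>E. \<exists>a\<in>A. \<exists>b\<in>B. e = {a, b})"

definition bipartite :: "'v::finite set set \<Rightarrow> bool" where
  "bipartite E \<longleftrightarrow> (\<exists>A B. bipartition E A B)"


definition cprob :: "'w measure \<Rightarrow> 'w measure \<Rightarrow> ('w \<Rightarrow> bool) \<Rightarrow> 'w \<Rightarrow> real" where
  "cprob M F P = real_cond_exp M F (indicator {\<omega> \<in> space M. P \<omega>})"

definition cond_indep_vars ::
    "'w measure \<Rightarrow> 'w measure \<Rightarrow> 'c measure \<Rightarrow> ('i \<Rightarrow> 'w \<Rightarrow> 'c) \<Rightarrow> 'i set \<Rightarrow> bool" where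
  "cond_indep_vars M F N X I \<longleftrightarrow>
     (\<forall>i\<in>I. X i \<in> measurable M N) \<and>
     (\<forall>J S. J \<subseteq> I \<longrightarrow> finite J \<longrightarrow> (\<forall>i\<in>J. S i \<in> sets N) \<longrightarrow>
        (AE \<omega> in M. cprob M F (\<lambda>\<omega>. \<forall>i\<in>J. X i \<omega> \<in> S i) \<omega>
                  = (\<Prod>i\<in>J. cprob M F (\<lambda>\<omega>. X i \<omega> \<in> S i) \<omega>)))"


text \<open>
  \<open>C n e \<omega>\<close> is the endpoint of the edge \<open>e\<close> that receives the ball which is added for \<open>e\<close> at
  step \<open>n + 1\<close>; \<open>B\<^sub>0\<close> gives the initial numbers of balls.
\<close>

primrec balls ::
    "'v::finite set set \<Rightarrow> ('v \<Rightarrow> nat) \<Rightarrow> (nat \<Rightarrow> 'v set \<Rightarrow> 'w \<Rightarrow> 'v) \<Rightarrow> nat \<Rightarrow> 'v \<Rightarrow> 'w \<Rightarrow> nat" where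
  "balls E B\<^sub>0 C 0 i \<omega> = B\<^sub>0 i"
| "balls E B\<^sub>0 C (Suc n) i \<omega> = balls E B\<^sub>0 C n i \<omega> + card {e \<in> E. C n e \<omega> = i}"

definition proportions ::
    "'v::finite set set \<Rightarrow> ('v \<Rightarrow> nat) \<Rightarrow> (nat \<Rightarrow> 'v set \<Rightarrow> 'w \<Rightarrow> 'v) \<Rightarrow> nat \<Rightarrow> 'w \<Rightarrow> real ^ 'v" where
  "proportions E B\<^sub>0 C n \<omega> =
     (\<chi> i. real (balls E B\<^sub>0 C n i \<omega>) / (real (\<Sum>j\<in>UNIV. B\<^sub>0 j) + real n * real (card E)))"

text \<open>
  The filtration is the natural one of the process of the numbers of balls. If the conditional
  laws required below hold with respect to a larger filtration to which this process is
  adapted (such as the one generated by the choices \<open>C\<close>), then they also hold for this one.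
\<close>

definition urn_filtration ::
    "'w measure \<Rightarrow> 'v::finite set set \<Rightarrow> ('v \<Rightarrow> nat) \<Rightarrow> (nat \<Rightarrow> 'v set \<Rightarrow> 'w \<Rightarrow> 'v) \<Rightarrow> nat \<Rightarrow> 'w measure" where
  "urn_filtration M E B\<^sub>0 C n =
     sigma (space M) {balls E B\<^sub>0 C k i -` S \<inter> space M | k i S. k \<le> n}"

locale polya_urn = prob_space M
  for M :: "'w measure" and E :: "'v::finite set set" and \<alpha> :: real
    and B\<^sub>0 :: "'v \<Rightarrow> nat" and C :: "nat \<Rightarrow> 'v set \<Rightarrow> 'w \<Rightarrow> 'v" +
  assumes alpha_pos: "\<alpha> > 0"
    and initial_pos: "\<And>i. B\<^sub>0 i \<ge> 1"
    and choice_measurable: "\<And>n e. e \<in> E \<Longrightarrow> C n e \<in> measurable M (count_space UNIV)"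
    and choice_in_edge: "\<And>n e \<omega>. e \<in> E \<Longrightarrow> \<omega> \<in> space M \<Longrightarrow> C n e \<omega> \<in> e"
    and choice_prob: "\<And>n i j. {i, j} \<in> E \<Longrightarrow>
          AE \<omega> in M. cprob M (urn_filtration M E B\<^sub>0 C n) (\<lambda>\<omega>. C n {i, j} \<omega> = i) \<omega> =
            real (balls E B\<^sub>0 C n i \<omega>) powr \<alpha> /
              (real (balls E B\<^sub>0 C n i \<omega>) powr \<alpha> + real (balls E B\<^sub>0 C n j \<omega>) powr \<alpha>)"
    and choice_indep: "\<And>n.
          cond_indep_vars M (urn_filtration M E B\<^sub>0 C n) (count_space UNIV) (C n) E"
begin

text \<open>
  The function \<open>real_cond_exp M F\<close> is a conditional expectation only if \<open>F\<close> is a subalgebra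
  of \<open>M\<close>, which is the case here.
\<close>

lemma balls_measurable: "balls E B\<^sub>0 C n i \<in> measurable M (count_space UNIV)"
proof (induction n)
  case 0
  then show ?case by simp
next
  case (Suc n)
  have eq: "balls E B\<^sub>0 C (Suc n) i =
      (\<lambda>\<omega>. balls E B\<^sub>0 C n i \<omega> + (\<Sum>e\<in>E. if C n e \<omega> = i then 1 else 0))"
    by (rule ext) (simp add: sum.If_cases Int_def)
  have meas: "(\<lambda>\<omega>. if C n e \<omega> = i then 1 else 0 :: nat) \<in> measurable M (count_space UNIV)"
    if "e \<in> E" for e
    using measurable_comp[OF choice_measurable[OF that, of n],
        of "\<lambda>v. if v = i then 1 else 0 :: nat" "count_space UNIV"]
    by (simp add: comp_def)
  have sum_meas: "(\<lambda>\<omega>. \<Sum>e\<in>D. if C n e \<omega> = i then 1 else 0 :: nat) \<in> measurable M (count_space UNIV)"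
    if "D \<subseteq> E" for D
    using finite[of D] that
  proof (induction D rule: finite_induct)
    case (insert e D)
    then have [measurable]:
      "(\<lambda>\<omega>. if C n e \<omega> = i then 1 else 0 :: nat) \<in> measurable M (count_space UNIV)"
      "(\<lambda>\<omega>. \<Sum>e\<in>D. if C n e \<omega> = i then 1 else 0 :: nat) \<in> measurable M (count_space UNIV)"
      using meas by blast+
    show ?case
      using insert.hyps by simp
  qed simp
  from sum_meas[of E] Suc show ?case
    unfolding eq by simp
qed

lemma subalgebra_urn_filtration: "subalgebra M (urn_filtration M E B\<^sub>0 C n)"
proof -
  have "sigma_sets (space M) {balls E B\<^sub>0 C k i -` S \<inter> space M | k i S. k \<le> n} \<subseteq> sets M"
    using measurable_sets[OF balls_measurable] by (intro sets.sigma_sets_subset) auto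
  then show ?thesis
    unfolding subalgebra_def urn_filtration_def
    by (subst sets_measure_of) (auto simp: space_measure_of_conv)
qed

end


definition prob_simplex :: "(real ^ 'v::finite) set" where
  "prob_simplex = {x. (\<forall>i. x $ i \<ge> 0) \<and> (\<Sum>i\<in>UNIV. x $ i) = 1}"

definition Omega :: "'v::finite set \<Rightarrow> 'v set \<Rightarrow> (real ^ 'v) set" where
  "Omega A B = {x \<in> prob_simplex. \<exists>p q. p \<ge> 0 \<and> q \<ge> 0 \<and> p + q = 2 / real CARD('v) \<and>
                  (\<forall>i\<in>A. x $ i = p) \<and> (\<forall>i\<in>B. x $ i = q)}"

text \<open>
  The function \<open>infdist\<close> returns 0 for the empty set by convention. This case does not arise
  for \<open>Omega A B\<close>, which always contains the uniform measure.
\<close>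

lemma uniform_in_Omega: "(\<chi> i. 1 / real CARD('v)) \<in> Omega A (B :: 'v::finite set)"
  unfolding Omega_def prob_simplex_def
  by (auto intro!: exI[of _ "1 / real CARD('v)"])

end

theory Submission
  imports Defs
begin

text \<open>
  Let \<open>G\<close> be \<open>d\<close>-regular with \<open>m\<close> vertices and \<open>N = m d / 2 > 0\<close> edges, let \<open>T\<close> be the total number
  of balls at time \<open>n\<close> and \<open>s\<^sub>e\<close> the number of balls on an edge \<open>e\<close>. The expected increment of
  \<open>\<Sum>\<^sub>i ln B\<^sub>i\<close> is about \<open>\<Sum>\<^sub>e 2 / s\<^sub>e\<close>, and since the \<open>s\<^sub>e\<close> sum to
  \<open>d T\<close>, this exceeds \<open>m N / T\<close> by at least a multiple of \<open>\<Sum>\<^sub>e (s\<^sub>e / T - 2 / m)\<^sup>2 / T\<close>. On the other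
  hand, \<open>\<Sum>\<^sub>i ln B\<^sub>i \<le> m ln T\<close>, which grows like the sum of the \<open>m N / T\<close>. Hence the excesses have
  a finite expected sum and are almost surely summable. As \<open>s\<^sub>e / T\<close> moves by \<open>O(1 / n)\<close> only, this
  forces \<open>x\<^sub>i + x\<^sub>j \<longlonglongrightarrow> 2 / m\<close> along every edge \<open>{i, j}\<close>. Going around the graph, \<open>x\<^sub>i - 1 / m\<close> is
  asymptotically determined up to a sign that alternates along edges, and both assertions follow.
\<close>

section \<open>Summability criteria and a discrete logarithm\<close>

text \<open>The step bound alone is only harmonic, which does not give convergence. Passing to
  squares helps: the increment of \<open>(V n)\<^sup>2\<close> gains the factor
  \<open>V (Suc n) + V n\<close>, so it is controlled by the given weighted series plus the series
  of inverse squares.\<close>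

lemma tendsto_zero_if_summable_weighted:
  fixes V :: "nat \<Rightarrow> real"
  assumes nonneg: "\<And>n. 0 \<le> V n" and summable: "summable (\<lambda>n. V n / real (Suc n))"
    and step: "\<And>n. \<bar>V (Suc n) - V n\<bar> \<le> L / real (Suc n)"
  shows "V \<longlonglongrightarrow> 0"
proof -
  have L: "L \<ge> 0"
    using step[of 0] by simp
  have bound: "norm ((V (Suc n))\<^sup>2 - (V n)\<^sup>2)
      \<le> 2 * L * (V n / real (Suc n)) + L\<^sup>2 * (1 / (real (Suc n))\<^sup>2)" for n
  proof -
    have "norm ((V (Suc n))\<^sup>2 - (V n)\<^sup>2) = \<bar>V (Suc n) - V n\<bar> * (V (Suc n) + V n)"
      using nonneg by (simp add: power2_eq_square square_diff_square_factored abs_mult mult.commute)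
    also have "\<dots> \<le> (L / real (Suc n)) * (2 * V n + L / real (Suc n))"
      using step[of n] nonneg[of n] nonneg[of "Suc n"] L by (intro mult_mono) auto
    also have "\<dots> = 2 * L * (V n / real (Suc n)) + L\<^sup>2 * (1 / (real (Suc n))\<^sup>2)"
      by (simp add: ring_distribs power2_eq_square)
    finally show ?thesis .
  qed
  have "summable (\<lambda>n. 1 / (real (Suc n))\<^sup>2)"
    using inverse_power_summable[of 2, where 'a = real]
    by (subst summable_Suc_iff) (simp add: inverse_eq_divide)
  then have "summable (\<lambda>n. 2 * L * (V n / real (Suc n)) + L\<^sup>2 * (1 / (real (Suc n))\<^sup>2))"
    using summable by (intro summable_add summable_mult)
  \<comment> \<open>hence the squares converge, and a positive limit would contradict the harmonic series\<close>
  then have "summable (\<lambda>n. (V (Suc n))\<^sup>2 - (V n)\<^sup>2)"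
    by (rule summable_comparison_test'[where N = 0]) (rule bound)
  then obtain a where "(\<lambda>n. \<Sum>k<n. (V (Suc k))\<^sup>2 - (V k)\<^sup>2) \<longlonglongrightarrow> a"
    using summable_LIMSEQ by blast
  from tendsto_add[OF this tendsto_const[of "(V 0)\<^sup>2"]]
  have "(\<lambda>n. (V n)\<^sup>2) \<longlonglongrightarrow> a + (V 0)\<^sup>2"
    by (simp add: sum_lessThan_telescope[of "\<lambda>n. (V n)\<^sup>2"])
  then obtain l where l: "(\<lambda>n. (V n)\<^sup>2) \<longlonglongrightarrow> l" ..
  have "l \<ge> 0"
    by (rule LIMSEQ_le_const[OF l]) auto
  from tendsto_real_sqrt[OF l] have V: "V \<longlonglongrightarrow> sqrt l"
    using nonneg by simp
  have "l = 0"
  proof (rule ccontr)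
    assume "l \<noteq> 0"
    then have pos: "sqrt l > 0" using \<open>l \<ge> 0\<close> by simp
    then have "eventually (\<lambda>n. V n > sqrt l / 2) sequentially"
      using order_tendstoD(1)[OF V, of "sqrt l / 2"] by simp
    then have "eventually (\<lambda>n. norm (sqrt l / 2 * inverse (real (Suc n))) \<le> V n / real (Suc n)) sequentially"
    proof eventually_elim
      case (elim n)
      then have "sqrt l / 2 * inverse (real (Suc n)) \<le> V n * inverse (real (Suc n))"
        by (intro mult_right_mono) auto
      moreover have "0 \<le> sqrt l / 2 * inverse (real (Suc n))"
        using pos by (intro mult_nonneg_nonneg) auto
      ultimately show ?case
        by (simp only: real_norm_def abs_of_nonneg divide_inverse[of "V n"])
    qed
    then have "summable (\<lambda>n. sqrt l / 2 * inverse (real (Suc n)))"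
      using summable by (rule summable_comparison_test_ev)
    then have "summable (\<lambda>n. inverse (real (Suc n)))"
      using pos by (simp add: summable_cmult_iff)
    then show False
      using not_summable_harmonic[where 'a = real] summable_Suc_iff[of "\<lambda>n. inverse (real n)"] by simp
  qed
  with V show ?thesis by simp
qed

text \<open>Summing under the integral in the extended nonnegative reals shows that the random
  series has expectation at most \<open>K\<close>, hence is finite almost everywhere.\<close>

lemma AE_summable_if_integrals_bounded:
  fixes f :: "nat \<Rightarrow> 'a \<Rightarrow> real"
  assumes int: "\<And>n. integrable M (f n)" and nonneg: "\<And>n x. 0 \<le> f n x"
    and bound: "\<And>n. (\<Sum>k<n. integral\<^sup>L M (f k)) \<le> K"
  shows "AE x in M. summable (\<lambda>n. f n x)"
proof -
  have [measurable]: "f n \<in> borel_measurable M" for n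
    using int by auto
  have "(\<integral>\<^sup>+x. (\<Sum>n. ennreal (f n x)) \<partial>M) = (\<Sum>n. \<integral>\<^sup>+x. ennreal (f n x) \<partial>M)"
    by (rule nn_integral_suminf) simp
  also have "\<dots> = (\<Sum>n. ennreal (integral\<^sup>L M (f n)))"
    using int nonneg by (intro suminf_cong nn_integral_eq_integral) auto
  also have "\<dots> \<le> ennreal K"
  proof (rule suminf_le_const)
    show "(\<Sum>k<n. ennreal (integral\<^sup>L M (f k))) \<le> ennreal K" for n
      using bound[of n] nonneg by (subst sum_ennreal) (auto intro: ennreal_leI)
  qed auto
  finally have "(\<integral>\<^sup>+x. (\<Sum>n. ennreal (f n x)) \<partial>M) \<noteq> \<infinity>"
    by (auto simp: top_unique)
  then have "AE x in M. (\<Sum>n. ennreal (f n x)) \<noteq> \<infinity>"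
    by (intro nn_integral_PInf_AE) auto
  then show ?thesis
    by eventually_elim (use nonneg in \<open>auto intro!: summable_suminf_not_top\<close>)
qed

text \<open>
  A logarithm up to a bounded error. The shift by \<open>d\<close> absorbs the concavity of the logarithm, so
  that increments by at most \<open>d\<close> satisfy the first-order bound exactly, without an error term
  that would require a lower bound on the growth of each bin.
\<close>
definition slow_harm :: "nat \<Rightarrow> nat \<Rightarrow> real" where
  "slow_harm d b = (\<Sum>k<b. 1 / real (Suc (k - d)))"

lemma slow_harm_nonneg: "0 \<le> slow_harm d b"
  by (simp add: slow_harm_def sum_nonneg)

lemma slow_harm_le: "slow_harm d b \<le> real b"
proof -
  have "slow_harm d b \<le> (\<Sum>k<b. 1)"
    unfolding slow_harm_def by (intro sum_mono) simp
  then show ?thesis by simp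
qed

text \<open>The new terms have indices \<open>k < b + d\<close>, so their denominators
  \<open>Suc (k - d)\<close> are at most \<open>b\<close>. Where the subtraction truncates to 0,
  this rests on \<open>b \<ge> 1\<close>.\<close>

lemma slow_harm_add_ge:
  assumes "b \<ge> 1"
  shows "t \<le> d \<Longrightarrow> slow_harm d b + real t / real b \<le> slow_harm d (b + t)"
proof (induction t)
  case (Suc t)
  have "1 / real b \<le> 1 / real (Suc (b + t - d))"
    using Suc.prems assms by (intro divide_left_mono) auto
  with Suc show ?case
    by (simp add: slow_harm_def add_divide_distrib)
qed simp

text \<open>The terms with \<open>k \<le> d\<close> are all 1 and contribute \<open>d + 1\<close>;
  the later ones form a harmonic sum, compared with increments of \<open>ln\<close>. The estimate is
  made at the larger argument \<open>d + b\<close>, which suffices by monotonicity.\<close>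

lemma slow_harm_le_ln:
  assumes "b \<ge> 1"
  shows "slow_harm d b \<le> real d + 1 + ln (real b)"
proof -
  have shift: "slow_harm d (d + Suc n) \<le> real d + 1 + ln (real (Suc n))" for n
  proof (induction n)
    case 0
    have "slow_harm d d = (\<Sum>k<d. 1)"
      unfolding slow_harm_def by (intro sum.cong) auto
    then show ?case by (simp add: slow_harm_def)
  next
    case (Suc n)
    have "1 / real (Suc (Suc n)) \<le> ln (real (Suc (Suc n))) - ln (real (Suc n))"
      using ln_diff_le[of "real (Suc n)" "real (Suc (Suc n))"] by simp
    with Suc show ?case
      by (simp add: slow_harm_def)
  qed
  have "slow_harm d b \<le> slow_harm d (d + b)"
    unfolding slow_harm_def by (intro sum_mono2) auto
  then show ?thesis
    using shift[of "b - 1"] assms by simp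
qed

section \<open>Sequences on the vertices whose edge sums tend to zero\<close>

text \<open>Along a path from \<open>w\<close>, crossing an edge turns an asymptotic value into its
  negative, so only the sign relative to \<open>w\<close> can change.\<close>

lemma edge_sums_tendsto_zero_dichotomy:
  fixes u :: "nat \<Rightarrow> 'v::finite \<Rightarrow> real"
  assumes con: "connected_graph E"
    and edge: "\<And>i j. {i, j} \<in> E \<Longrightarrow> (\<lambda>n. u n i + u n j) \<longlonglongrightarrow> 0"
  shows "(\<lambda>n. u n v - u n w) \<longlonglongrightarrow> 0 \<or> (\<lambda>n. u n v + u n w) \<longlonglongrightarrow> 0"
proof -
  have "(w, v) \<in> {(i, j). {i, j} \<in> E}\<^sup>*"
    using con by (simp add: connected_graph_def)
  then show ?thesis
  proof (induction rule: rtrancl_induct)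
    case (step i j)
    then have ij: "(\<lambda>n. u n i + u n j) \<longlonglongrightarrow> 0" using edge by simp
    from step.IH show ?case
    proof
      assume "(\<lambda>n. u n i - u n w) \<longlonglongrightarrow> 0"
      from tendsto_diff[OF ij this] show ?thesis by simp
    next
      assume "(\<lambda>n. u n i + u n w) \<longlonglongrightarrow> 0"
      from tendsto_diff[OF ij this] show ?thesis by simp
    qed
  qed simp
qed

text \<open>Sort the vertices by their sign relative to \<open>v\<close>. The two classes cover the
  graph and every edge joins one to the other, so without a bipartition they must share a vertex
  \<open>i\<close>. Half the difference of the two limits at \<open>i\<close> is the claim.\<close>

lemma edge_sums_tendsto_zero_nonbipartite:
  fixes u :: "nat \<Rightarrow> 'v::finite \<Rightarrow> real"
  assumes simple: "simple_graph E" and con: "connected_graph E" and nonbip: "\<not> bipartite E"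
    and edge: "\<And>i j. {i, j} \<in> E \<Longrightarrow> (\<lambda>n. u n i + u n j) \<longlonglongrightarrow> 0"
  shows "(\<lambda>n. u n v) \<longlonglongrightarrow> 0"
proof -
  define A where "A = {i. (\<lambda>n. u n i - u n v) \<longlonglongrightarrow> 0}"
  define B where "B = {i. (\<lambda>n. u n i + u n v) \<longlonglongrightarrow> 0}"
  have Un: "A \<union> B = UNIV"
    using edge_sums_tendsto_zero_dichotomy[where u = u, OF con edge] by (auto simp: A_def B_def)
  have AB: "j \<in> B" if "{i, j} \<in> E" "i \<in> A" for i j
    using tendsto_diff[OF edge[OF that(1)], of "\<lambda>n. u n i - u n v" 0] that(2) by (simp add: A_def B_def)
  have BA: "j \<in> A" if "{i, j} \<in> E" "i \<in> B" for i j
    using tendsto_diff[OF edge[OF that(1)], of "\<lambda>n. u n i + u n v" 0] that(2) by (simp add: A_def B_def)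
  have "\<exists>a\<in>A. \<exists>b\<in>B. e = {a, b}" if "e \<in> E" for e
  proof -
    have "card e = 2" using simple that by (simp add: simple_graph_def)
    then obtain i j where e: "e = {i, j}" by (auto simp: card_2_iff)
    with that have ij: "{i, j} \<in> E" by simp
    have "i \<in> A \<or> i \<in> B" using Un by blast
    then show ?thesis
    proof
      assume "i \<in> A"
      with AB[OF ij] e show ?thesis by blast
    next
      assume "i \<in> B"
      with BA[OF ij] e show ?thesis by blast
    qed
  qed
  with Un nonbip have "A \<inter> B \<noteq> {}"
    unfolding bipartite_def bipartition_def by blast
  then obtain i where "(\<lambda>n. u n i - u n v) \<longlonglongrightarrow> 0" "(\<lambda>n. u n i + u n v) \<longlonglongrightarrow> 0"
    by (auto simp: A_def B_def)
  from tendsto_mult[OF tendsto_const[of "1 / 2"] tendsto_diff[OF this(2,1)]] show ?thesis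
    by simp
qed

lemma edge_sums_tendsto_zero_bipartite:
  fixes u :: "nat \<Rightarrow> 'v::finite \<Rightarrow> real"
  assumes con: "connected_graph E" and bip: "bipartition E A B"
    and edge: "\<And>i j. {i, j} \<in> E \<Longrightarrow> (\<lambda>n. u n i + u n j) \<longlonglongrightarrow> 0"
    and same: "v \<in> A \<longleftrightarrow> w \<in> A"
  shows "(\<lambda>n. u n v - u n w) \<longlonglongrightarrow> 0"
proof -
  have "(w, v) \<in> {(i, j). {i, j} \<in> E}\<^sup>*"
    using con by (simp add: connected_graph_def)
  \<comment> \<open>Every edge changes sides, so the induction has to carry the opposite-side case
    along.\<close>
  then have "((v \<in> A) = (w \<in> A) \<longrightarrow> (\<lambda>n. u n v - u n w) \<longlonglongrightarrow> 0) \<and>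
      ((v \<in> A) \<noteq> (w \<in> A) \<longrightarrow> (\<lambda>n. u n v + u n w) \<longlonglongrightarrow> 0)"
  proof (induction rule: rtrancl_induct)
    case (step i j)
    then have "{i, j} \<in> E" by simp
    then have "(i \<in> A) \<noteq> (j \<in> A)"
      using bip by (fastforce simp: bipartition_def doubleton_eq_iff)
    moreover have ij: "(\<lambda>n. u n i + u n j) \<longlonglongrightarrow> 0" using edge \<open>{i, j} \<in> E\<close> by simp
    ultimately show ?case
      using step.IH tendsto_diff[OF ij, of "\<lambda>n. u n i - u n w" 0]
        tendsto_diff[OF ij, of "\<lambda>n. u n i + u n w" 0] by auto
  qed simp
  with same show ?thesis by blast
qed

section \<open>Counting balls on a regular graph\<close>

text \<open>Positive degree guarantees an edge, so that the total number of balls grows linearly.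
  The edgeless graph is treated directly in the theorem.\<close>

locale regular_urn = polya_urn M E 1 B\<^sub>0 C
  for M :: "'w measure" and E :: "'v::finite set set"
    and B\<^sub>0 :: "'v \<Rightarrow> nat" and C :: "nat \<Rightarrow> 'v set \<Rightarrow> 'w \<Rightarrow> 'v" +
  fixes d :: nat
  assumes simple: "simple_graph E" and degree_eq: "degree E v = d" and d_pos: "d > 0"
begin

abbreviation "cnt \<equiv> balls E B\<^sub>0 C"

definition total :: "nat \<Rightarrow> real" where
  "total n = real (\<Sum>j\<in>UNIV. B\<^sub>0 j) + real n * real (card E)"

definition edge_balls :: "nat \<Rightarrow> 'v set \<Rightarrow> 'w \<Rightarrow> real" where
  "edge_balls n e \<omega> = (\<Sum>i\<in>e. real (cnt n i \<omega>))"

text \<open>The value \<open>2 / m\<close> is the average over the edges of the share of balls on an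
  edge: these shares sum to \<open>d\<close>, and there are \<open>m d / 2\<close> edges.\<close>

definition deviation :: "nat \<Rightarrow> 'v set \<Rightarrow> 'w \<Rightarrow> real" where
  "deviation n e \<omega> = edge_balls n e \<omega> / total n - 2 / real CARD('v)"

definition potential :: "nat \<Rightarrow> 'w \<Rightarrow> real" where
  "potential n \<omega> = (\<Sum>i\<in>UNIV. slow_harm d (cnt n i \<omega>))"

text \<open>Double counting of incidences. It yields the handshake identity, the sum of all
  \<open>edge_balls\<close>, and the sizes of the two sides of a bipartition.\<close>

lemma sum_edges_swap: "(\<Sum>e\<in>E. \<Sum>i\<in>e. f i) = real d * (\<Sum>i\<in>UNIV. f i)" for f :: "'v \<Rightarrow> real"
proof -
  have "(\<Sum>e\<in>E. \<Sum>i\<in>e. f i) = (\<Sum>e\<in>E. \<Sum>i\<in>UNIV. if i \<in> e then f i else 0)"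
    by (simp add: sum.If_cases)
  also have "\<dots> = (\<Sum>i\<in>UNIV. \<Sum>e\<in>E. if i \<in> e then f i else 0)"
    by (rule sum.swap)
  also have "\<dots> = (\<Sum>i\<in>UNIV. real d * f i)"
    using degree_eq by (intro sum.cong) (auto simp: sum.If_cases degree_def Int_def)
  finally show ?thesis
    by (simp add: sum_distrib_left)
qed

lemma edgeE:
  assumes "e \<in> E"
  obtains i j where "e = {i, j}" "i \<noteq> j"
proof -
  have "card e = 2" using simple assms by (simp add: simple_graph_def)
  then show thesis using that by (auto simp: card_2_iff)
qed

lemma handshake: "2 * real (card E) = real d * real CARD('v)"
proof -
  have "(\<Sum>e\<in>E. \<Sum>i\<in>e. 1 :: real) = (\<Sum>e\<in>E. 2)"
    using simple by (intro sum.cong) (auto simp: simple_graph_def)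
  then show ?thesis
    using sum_edges_swap[of "\<lambda>_. 1"] by simp
qed

lemma card_E_pos: "card E > 0"
proof -
  have "real (card E) > 0"
    using handshake d_pos by (smt (verit) mult_pos_pos of_nat_0_less_iff zero_less_card_finite)
  then show ?thesis by simp
qed

lemma two_le_CARD: "2 \<le> CARD('v)"
proof -
  obtain e where "e \<in> E" using card_E_pos by (metis card_gt_0_iff ex_in_conv)
  then have "card e = 2" using simple by (simp add: simple_graph_def)
  then show ?thesis by (metis card_mono finite subset_UNIV)
qed

lemma ball_pos: "cnt n i \<omega> \<ge> 1"
  by (induction n) (use initial_pos in \<open>auto intro: le_trans trans_le_add1\<close>)

lemma sum_B\<^sub>0_pos: "real (\<Sum>j\<in>UNIV. B\<^sub>0 j) \<ge> 1"
  using initial_pos member_le_sum[of undefined UNIV B\<^sub>0] 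
  by (metis UNIV_I finite le_trans of_nat_1 of_nat_le_iff zero_le)

lemma total_ge: "total n \<ge> 1"
  using sum_B\<^sub>0_pos by (simp add: total_def add_increasing2 del: of_nat_sum)

lemma total_Suc: "total (Suc n) = total n + real (card E)"
  by (simp add: total_def ring_distribs)

lemma sum_card_choices: "(\<Sum>i\<in>S. card {e \<in> E. f e = i}) = card {e \<in> E. f e \<in> S}" for f :: "'v set \<Rightarrow> 'v"
proof -
  have "card {e \<in> E. f e \<in> S} = card (\<Union>i\<in>S. {e \<in> E. f e = i})"
    by (rule arg_cong[where f = card]) auto
  also have "\<dots> = (\<Sum>i\<in>S. card {e \<in> E. f e = i})"
    by (rule card_UN_disjoint) auto
  finally show ?thesis ..
qed

lemma sum_ball: "(\<Sum>i\<in>UNIV. real (cnt n i \<omega>)) = total n"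
proof (induction n)
  case (Suc n)
  then show ?case
    using sum_card_choices[of "\<lambda>e. C n e \<omega>" UNIV]
    by (simp add: sum.distrib total_Suc flip: of_nat_sum)
qed (simp add: total_def)

lemma edge_balls_pair: "i \<noteq> j \<Longrightarrow> edge_balls n {i, j} \<omega> = real (cnt n i \<omega>) + real (cnt n j \<omega>)"
  by (simp add: edge_balls_def)

lemma edge_balls_pos: "e \<in> E \<Longrightarrow> edge_balls n e \<omega> \<ge> 1"
  by (erule edgeE) (use ball_pos[of n] in \<open>auto simp: edge_balls_pair intro: add_increasing2\<close>)

lemma edge_balls_le: "edge_balls n e \<omega> \<le> total n"
  unfolding edge_balls_def sum_ball[of n \<omega>, symmetric] by (intro sum_mono2) auto

lemma edge_balls_nonneg: "0 \<le> edge_balls n e \<omega>"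
  unfolding edge_balls_def by (intro sum_nonneg) auto

text \<open>If \<open>t\<close> of the \<open>N\<close> new balls land on \<open>e\<close>, which
  held \<open>s\<close> of the \<open>T\<close> balls, the change is
  \<open>(t T - s N) / (T (T + N))\<close>. Both products in the numerator lie between 0 and
  \<open>N T\<close>, and \<open>T + N\<close> is at least \<open>(n + 1) N\<close>.\<close>

lemma deviation_step:
  "\<bar>deviation (Suc n) e \<omega> - deviation n e \<omega>\<bar> \<le> 1 / real (Suc n)"
proof -
  define t where "t = real (card {e' \<in> E. C n e' \<omega> \<in> e})"
  have t: "0 \<le> t" "t \<le> real (card E)"
    unfolding t_def by (auto intro: card_mono)
  have s: "edge_balls (Suc n) e \<omega> = edge_balls n e \<omega> + t"
    using sum_card_choices[of "\<lambda>e. C n e \<omega>" e]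
    by (simp add: edge_balls_def sum.distrib t_def flip: of_nat_sum)
  have T: "total n > 0" "total (Suc n) > 0"
    using total_ge[of n] total_ge[of "Suc n"] by auto
  have "deviation (Suc n) e \<omega> - deviation n e \<omega> =
      (edge_balls n e \<omega> + t) / total (Suc n) - edge_balls n e \<omega> / total n"
    by (simp add: deviation_def s)
  also have "\<dots> = ((edge_balls n e \<omega> + t) * total n - edge_balls n e \<omega> * total (Suc n)) /
      (total (Suc n) * total n)"
    using T by (intro diff_frac_eq) auto
  also have "\<dots> = (t * total n - edge_balls n e \<omega> * real (card E)) / (total n * total (Suc n))"
    by (simp add: total_Suc algebra_simps)
  finally have "deviation (Suc n) e \<omega> - deviation n e \<omega> =
      (t * total n - edge_balls n e \<omega> * real (card E)) / (total n * total (Suc n))" .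
  moreover have "\<bar>t * total n - edge_balls n e \<omega> * real (card E)\<bar> \<le> real (card E) * total n"
  proof -
    have "t * total n \<le> real (card E) * total n"
      using t T by (intro mult_right_mono) auto
    moreover have "edge_balls n e \<omega> * real (card E) \<le> total n * real (card E)"
      by (intro mult_right_mono edge_balls_le) auto
    moreover have "0 \<le> t * total n" "0 \<le> edge_balls n e \<omega> * real (card E)"
      using t T edge_balls_nonneg by auto
    ultimately show ?thesis by (simp add: abs_le_iff mult.commute)
  qed
  moreover have "\<bar>total n * total (Suc n)\<bar> = total n * total (Suc n)"
    using T by simp
  ultimately have "\<bar>deviation (Suc n) e \<omega> - deviation n e \<omega>\<bar> \<le>
      real (card E) * total n / (total n * total (Suc n))"
    using T by (simp only: abs_divide) (intro divide_right_mono, auto)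
  also have "\<dots> = real (card E) / total (Suc n)"
    using T by simp
  also have "\<dots> \<le> real (card E) / (real (Suc n) * real (card E))"
    using card_E_pos T by (intro divide_left_mono) (auto simp: total_def sum_nonneg)
  also have "\<dots> = 1 / real (Suc n)"
    using card_E_pos by auto
  finally show ?thesis .
qed

lemma deviation_abs_le: "\<bar>deviation n e \<omega>\<bar> \<le> 1"
proof -
  have "0 \<le> edge_balls n e \<omega> / total n" "edge_balls n e \<omega> / total n \<le> 1"
    using edge_balls_nonneg edge_balls_le[of n e \<omega>] total_ge[of n] by (auto simp: divide_le_eq)
  moreover have "0 \<le> 2 / real CARD('v)" "2 / real CARD('v) \<le> 1"
    using two_le_CARD by (auto simp: divide_le_eq)
  ultimately show ?thesis
    unfolding deviation_def by linarith
qed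

lemma deviation_sq_step:
  "\<bar>(deviation (Suc n) e \<omega>)\<^sup>2 - (deviation n e \<omega>)\<^sup>2\<bar> \<le> 2 / real (Suc n)"
proof -
  have "\<bar>(deviation (Suc n) e \<omega>)\<^sup>2 - (deviation n e \<omega>)\<^sup>2\<bar> =
      \<bar>deviation (Suc n) e \<omega> - deviation n e \<omega>\<bar> * \<bar>deviation (Suc n) e \<omega> + deviation n e \<omega>\<bar>"
    by (simp add: power2_eq_square square_diff_square_factored abs_mult mult.commute)
  also have "\<dots> \<le> (1 / real (Suc n)) * 2"
    using deviation_step[of n e \<omega>] deviation_abs_le[of n e \<omega>] deviation_abs_le[of "Suc n" e \<omega>]
    by (intro mult_mono) auto
  finally show ?thesis by simp
qed

lemma deviation_summable_imp_tendsto: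
  assumes "summable (\<lambda>n. (deviation n e \<omega>)\<^sup>2 / total n)"
  shows "(\<lambda>n. deviation n e \<omega>) \<longlonglongrightarrow> 0"
proof -
  \<comment> \<open>This \<open>K\<close> satisfies \<open>total n \<le> K * real (Suc n)\<close>,
    so the weight \<open>1 / total n\<close> can be exchanged for
    \<open>1 / real (Suc n)\<close>.\<close>
  define K where "K = total 0 + real (card E)"
  have "K \<ge> 0" using total_ge[of 0] by (simp add: K_def)
  have "norm ((deviation n e \<omega>)\<^sup>2 / real (Suc n)) \<le> K * ((deviation n e \<omega>)\<^sup>2 / total n)" for n
  proof -
    have "total n \<le> K * real (Suc n)"
      using total_ge[of 0] by (simp add: K_def total_def algebra_simps sum_nonneg)
    then have "1 / real (Suc n) \<le> K / total n"
      using total_ge[of n] by (simp add: field_simps)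
    from mult_right_mono[OF this, of "(deviation n e \<omega>)\<^sup>2"] show ?thesis by simp
  qed
  then have "summable (\<lambda>n. (deviation n e \<omega>)\<^sup>2 / real (Suc n))"
    by (rule summable_comparison_test'[where N = 0, OF summable_mult[OF assms, of K]])
  from tendsto_zero_if_summable_weighted[OF _ this deviation_sq_step]
  have "(\<lambda>n. (deviation n e \<omega>)\<^sup>2) \<longlonglongrightarrow> 0" by simp
  from tendsto_real_sqrt[OF this] show ?thesis
    by (simp add: tendsto_rabs_zero_iff)
qed

section \<open>Pathwise bounds for the potential and its increments\<close>

lemma sum_inverse_edge_balls_ge:
  "(\<Sum>e\<in>E. 2 / edge_balls n e \<omega>) \<ge>
    real CARD('v) * real (card E) / total n
    + (real CARD('v))\<^sup>2 / 2 * (\<Sum>e\<in>E. (deviation n e \<omega>)\<^sup>2 / total n)"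
proof -
  define m where "m = real CARD('v)"
  have m: "m > 0" by (simp add: m_def)
  have T: "total n \<ge> 1" by (rule total_ge)
  have "(\<Sum>e\<in>E. 2 / edge_balls n e \<omega>) \<ge>
     (\<Sum>e\<in>E. (2 * m - m\<^sup>2 / 2 * (edge_balls n e \<omega> / total n) + m\<^sup>2 / 2 * (deviation n e \<omega>)\<^sup>2) / total n)"
  proof (rule sum_mono)
    fix e assume "e \<in> E"
    define y where "y = edge_balls n e \<omega> / total n"
    have y: "0 < y" "y \<le> 1"
      using edge_balls_pos[OF \<open>e \<in> E\<close>, of n \<omega>] edge_balls_le[of n e \<omega>] T
      by (auto simp: y_def divide_le_eq)
    have dev: "deviation n e \<omega> = y - 2 / m"
      by (simp add: deviation_def y_def m_def)
    have "m\<^sup>2 / 2 * (y - 2 / m)\<^sup>2 * 1 \<le> m\<^sup>2 / 2 * (y - 2 / m)\<^sup>2 * (1 / y)"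
      using y by (intro mult_left_mono) auto
    also have "\<dots> = 2 / y - 2 * m + m\<^sup>2 / 2 * y"
      using y m by (simp add: field_simps power2_eq_square)
    finally have "2 * m - m\<^sup>2 / 2 * y + m\<^sup>2 / 2 * (deviation n e \<omega>)\<^sup>2 \<le> 2 / y"
      by (simp add: dev)
    then have "(2 * m - m\<^sup>2 / 2 * y + m\<^sup>2 / 2 * (deviation n e \<omega>)\<^sup>2) / total n \<le> 2 / y / total n"
      using T by (intro divide_right_mono) auto
    moreover have "2 / y / total n = 2 / edge_balls n e \<omega>"
      using T by (simp add: y_def)
    ultimately show "(2 * m - m\<^sup>2 / 2 * (edge_balls n e \<omega> / total n) + m\<^sup>2 / 2 * (deviation n e \<omega>)\<^sup>2) / total n
        \<le> 2 / edge_balls n e \<omega>"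
      unfolding y_def by simp
  qed
  also have "(\<Sum>e\<in>E. (2 * m - m\<^sup>2 / 2 * (edge_balls n e \<omega> / total n) + m\<^sup>2 / 2 * (deviation n e \<omega>)\<^sup>2) / total n)
      = (2 * m * real (card E) - m\<^sup>2 / 2 * ((\<Sum>e\<in>E. edge_balls n e \<omega>) / total n)) / total n
        + m\<^sup>2 / 2 * (\<Sum>e\<in>E. (deviation n e \<omega>)\<^sup>2 / total n)"
    by (simp add: sum.distrib sum_subtractf sum_distrib_left sum_divide_distrib
        add_divide_distrib diff_divide_distrib mult.commute)
  also have "(\<Sum>e\<in>E. edge_balls n e \<omega>) / total n = real d"
    using T sum_edges_swap[of "\<lambda>i. real (cnt n i \<omega>)"] by (simp add: edge_balls_def sum_ball)
  also have "2 * m * real (card E) - m\<^sup>2 / 2 * real d = m * real (card E)"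
    using handshake by (simp add: m_def power2_eq_square algebra_simps)
  finally show ?thesis
    by (simp add: m_def)
qed

text \<open>A bin receives at most one ball from each of its \<open>d\<close> incident edges, which
  is the range where \<open>slow_harm_add_ge\<close> applies.\<close>

lemma potential_step:
  assumes "\<omega> \<in> space M"
  shows "potential n \<omega> + (\<Sum>e\<in>E. 1 / real (cnt n (C n e \<omega>) \<omega>)) \<le> potential (Suc n) \<omega>"
proof -
  have "card {e \<in> E. C n e \<omega> = i} \<le> d" for i
    unfolding degree_eq[symmetric, of i] degree_def
    using choice_in_edge[OF _ assms] by (intro card_mono) auto
  then have "(\<Sum>i\<in>UNIV. slow_harm d (cnt n i \<omega>) + real (card {e \<in> E. C n e \<omega> = i}) / real (cnt n i \<omega>))
      \<le> potential (Suc n) \<omega>"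
    unfolding potential_def by (intro sum_mono) (use slow_harm_add_ge[OF ball_pos] in simp)
  \<comment> \<open>Regroup the edges by the endpoint that receives the ball.\<close>
  moreover have "(\<Sum>i\<in>UNIV. real (card {e \<in> E. C n e \<omega> = i}) / real (cnt n i \<omega>))
      = (\<Sum>i\<in>UNIV. \<Sum>e\<in>{e \<in> E. C n e \<omega> = i}. 1 / real (cnt n (C n e \<omega>) \<omega>))"
    by (intro sum.cong) auto
  moreover have "\<dots> = (\<Sum>e\<in>E. 1 / real (cnt n (C n e \<omega>) \<omega>))"
    by (rule sum.group) auto
  ultimately show ?thesis
    unfolding sum.distrib potential_def[of n] by linarith
qed

lemma potential_nonneg: "0 \<le> potential n \<omega>"
  by (simp add: potential_def sum_nonneg slow_harm_nonneg)

lemma potential_le: "potential n \<omega> \<le> total n"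
  unfolding potential_def sum_ball[of n \<omega>, symmetric] by (intro sum_mono slow_harm_le)

lemma potential_le_ln: "potential n \<omega> \<le> real CARD('v) * (real d + 1 + ln (total n))"
proof -
  have "potential n \<omega> \<le> (\<Sum>i\<in>(UNIV :: 'v set). real d + 1 + ln (total n))"
    unfolding potential_def
  proof (intro sum_mono)
    fix i
    have "real (cnt n i \<omega>) \<le> total n"
      unfolding sum_ball[of n \<omega>, symmetric] by (intro member_le_sum) auto
    then have "ln (real (cnt n i \<omega>)) \<le> ln (total n)"
      using ball_pos[of n i \<omega>] by simp
    then show "slow_harm d (cnt n i \<omega>) \<le> real d + 1 + ln (total n)"
      using slow_harm_le_ln[OF ball_pos, of d n i \<omega>] by linarith
  qed
  then show ?thesis by simp
qed

text \<open>This lets the main part of the drift, the sum of the \<open>m N / T\<close>, absorb the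
  logarithmic growth allowed by \<open>potential_le_ln\<close>.\<close>

lemma ln_total_le: "ln (total n) - ln (total 0) \<le> (\<Sum>k<n. real (card E) / total k)"
proof (induction n)
  case (Suc n)
  have "ln (total (Suc n)) - ln (total n) \<le> real (card E) / total n"
    using ln_diff_le[of "total (Suc n)" "total n"] total_ge[of n] total_ge[of "Suc n"]
    by (simp add: total_Suc)
  with Suc show ?case by simp
qed simp

section \<open>Measurability and expected increments\<close>

lemma ball_measurable_filtration:
  "cnt n i \<in> measurable (urn_filtration M E B\<^sub>0 C n) (count_space UNIV)"
proof (rule measurableI)
  fix S :: "nat set"
  let ?G = "{balls E B\<^sub>0 C k i -` S \<inter> space M | k i S. k \<le> n}"
  have "cnt n i -` S \<inter> space M \<in> sigma_sets (space M) ?G"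
    by (rule sigma_sets.Basic) blast
  moreover have "?G \<subseteq> Pow (space M)" by auto
  ultimately show "cnt n i -` S \<inter> space (urn_filtration M E B\<^sub>0 C n) \<in> sets (urn_filtration M E B\<^sub>0 C n)"
    by (simp add: urn_filtration_def space_measure_of_conv sets_measure_of)
qed simp

lemma ball_borel [measurable]: "(\<lambda>\<omega>. real (cnt n i \<omega>)) \<in> borel_measurable M"
  using measurable_comp[OF balls_measurable[of n i], of real borel] by (simp add: comp_def)

lemma slow_harm_borel [measurable]: "(\<lambda>\<omega>. slow_harm d (cnt n i \<omega>)) \<in> borel_measurable M"
  using measurable_comp[OF balls_measurable[of n i], of "slow_harm d" borel] by (simp add: comp_def)

lemma inverse_ball_borel: "(\<lambda>\<omega>. 1 / real (cnt n i \<omega>)) \<in> borel_measurable (urn_filtration M E B\<^sub>0 C n)"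
  using measurable_comp[OF ball_measurable_filtration[of n i], of "\<lambda>b. 1 / real b" borel] by (simp add: comp_def)

lemma edge_balls_borel [measurable]: "edge_balls n e \<in> borel_measurable M"
  unfolding edge_balls_def by measurable

lemma deviation_borel [measurable]: "deviation n e \<in> borel_measurable M"
  unfolding deviation_def by measurable

lemma potential_borel [measurable]: "potential n \<in> borel_measurable M"
  unfolding potential_def by measurable

lemma integrable_potential: "integrable M (potential n)"
  by (rule integrable_const_bound[where B = "total n"])
    (use potential_nonneg potential_le in auto)

lemma integrable_inverse_edge_balls: "e \<in> E \<Longrightarrow> integrable M (\<lambda>\<omega>. 1 / edge_balls n e \<omega>)"
proof (rule integrable_const_bound[where B = 1])
  assume "e \<in> E"
  from edge_balls_pos[OF this] have "norm (1 / edge_balls n e \<omega>) \<le> 1" for \<omega>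
    by (simp add: divide_le_eq abs_of_nonneg[OF edge_balls_nonneg])
  then show "AE \<omega> in M. norm (1 / edge_balls n e \<omega>) \<le> 1" by simp
qed simp

lemma integrable_deviation: "integrable M (\<lambda>\<omega>. (deviation n e \<omega>)\<^sup>2 / total n)"
proof (rule integrable_const_bound[where B = 1])
  have "(deviation n e \<omega>)\<^sup>2 \<le> 1" for \<omega>
    using deviation_abs_le by (simp add: abs_square_le_1)
  then have "(deviation n e \<omega>)\<^sup>2 \<le> total n" for \<omega>
    using total_ge[of n] by (rule order_trans)
  then show "AE \<omega> in M. norm ((deviation n e \<omega>)\<^sup>2 / total n) \<le> 1"
    using total_ge[of n] by (simp add: divide_le_eq)
qed simp

lemma choice_event: "e \<in> E \<Longrightarrow> {\<omega> \<in> space M. C n e \<omega> = i} \<in> sets M"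
  using measurable_sets[OF choice_measurable, of e "{i}" n] by (simp add: vimage_def Int_def conj_commute)

text \<open>The factor \<open>1 / B_i\<close> is known at time \<open>n\<close>, so the indicator
  may be replaced by its conditional probability \<open>B_i / (B_i + B_j)\<close>, where
  \<open>B_i\<close> cancels. The result is symmetric in the two endpoints.\<close>

lemma integral_choice:
  fixes n :: nat
  assumes e: "{i, j} \<in> E" and ne: "i \<noteq> j"
  defines "f \<equiv> \<lambda>\<omega>. 1 / real (cnt n i \<omega>) * indicator {\<omega> \<in> space M. C n {i, j} \<omega> = i} \<omega>"
  shows "integrable M f" and "integral\<^sup>L M f = (\<integral>\<omega>. 1 / edge_balls n {i, j} \<omega> \<partial>M)"
proof -
  interpret sub: sigma_finite_subalgebra M "urn_filtration M E B\<^sub>0 C n"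
    by (rule finite_measure_subalgebra_is_sigma_finite)
      (simp add: finite_measure_subalgebra_def finite_measure_subalgebra_axioms_def
        subalgebra_urn_filtration finite_measure_axioms)
  have [measurable]: "{\<omega> \<in> space M. C n {i, j} \<omega> = i} \<in> sets M"
    using e by (rule choice_event)
  show int: "integrable M f"
    unfolding f_def
  proof (rule integrable_const_bound[where B = 1])
    show "AE \<omega> in M. norm (1 / real (cnt n i \<omega>) * indicator {\<omega> \<in> space M. C n {i, j} \<omega> = i} \<omega> :: real) \<le> 1"
      using ball_pos[of n i] by (auto simp: indicator_def divide_le_eq)
  qed measurable
  have "integral\<^sup>L M f = (\<integral>\<omega>. 1 / real (cnt n i \<omega>) *
      cprob M (urn_filtration M E B\<^sub>0 C n) (\<lambda>\<omega>. C n {i, j} \<omega> = i) \<omega> \<partial>M)"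
    unfolding cprob_def f_def
    using int by (intro sub.real_cond_exp_intg(2)[symmetric] inverse_ball_borel) (auto simp: f_def)
  also have "\<dots> = (\<integral>\<omega>. 1 / edge_balls n {i, j} \<omega> \<partial>M)"
  proof (rule integral_cong_AE)
    show "AE \<omega> in M. 1 / real (cnt n i \<omega>) *
        cprob M (urn_filtration M E B\<^sub>0 C n) (\<lambda>\<omega>. C n {i, j} \<omega> = i) \<omega> = 1 / edge_balls n {i, j} \<omega>"
      using choice_prob[OF e, of n]
    proof eventually_elim
      case (elim \<omega>)
      then show ?case
        using ball_pos[of n i \<omega>] ball_pos[of n j \<omega>] ne by (simp add: edge_balls_pair)
    qed
  qed (auto simp: cprob_def)
  finally show "integral\<^sup>L M f = (\<integral>\<omega>. 1 / edge_balls n {i, j} \<omega> \<partial>M)" .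
qed

text \<open>Split according to which endpoint is chosen; each contributes the same integral.\<close>

lemma integral_inverse_chosen:
  fixes n :: nat
  assumes "e \<in> E"
  defines "f \<equiv> \<lambda>\<omega>. 1 / real (cnt n (C n e \<omega>) \<omega>)"
  shows "integrable M f" and "integral\<^sup>L M f = (\<integral>\<omega>. 2 / edge_balls n e \<omega> \<partial>M)"
proof -
  obtain i j where e: "e = {i, j}" "i \<noteq> j" using assms(1) by (rule edgeE)
  define g where "g = (\<lambda>i \<omega>. 1 / real (cnt n i \<omega>) * indicator {\<omega> \<in> space M. C n e \<omega> = i} \<omega> :: real)"
  have f: "f \<omega> = g i \<omega> + g j \<omega>" if "\<omega> \<in> space M" for \<omega>
    using choice_in_edge[OF assms(1) that, of n] that e by (auto simp: f_def g_def)
  have ij: "integrable M (g i)" "integral\<^sup>L M (g i) = (\<integral>\<omega>. 1 / edge_balls n e \<omega> \<partial>M)"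
    using integral_choice[of i j n] assms(1) e by (auto simp: g_def)
  have ji: "integrable M (g j)" "integral\<^sup>L M (g j) = (\<integral>\<omega>. 1 / edge_balls n e \<omega> \<partial>M)"
    using integral_choice[of j i n] assms(1) e by (auto simp: g_def insert_commute)
  show "integrable M f"
    using Bochner_Integration.integrable_add[OF ij(1) ji(1)] f by (simp cong: Bochner_Integration.integrable_cong)
  have "integral\<^sup>L M f = integral\<^sup>L M (g i) + integral\<^sup>L M (g j)"
    using f ij ji by (simp cong: Bochner_Integration.integral_cong)
  also have "\<dots> = (\<integral>\<omega>. 2 * (1 / edge_balls n e \<omega>) \<partial>M)"
    unfolding ij ji by (subst integral_mult_right_zero) simp
  finally show "integral\<^sup>L M f = (\<integral>\<omega>. 2 / edge_balls n e \<omega> \<partial>M)" by simp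
qed

lemma integral_potential_step:
  "integral\<^sup>L M (potential n) + real CARD('v) * real (card E) / total n
    + (real CARD('v))\<^sup>2 / 2 * (\<integral>\<omega>. (\<Sum>e\<in>E. (deviation n e \<omega>)\<^sup>2 / total n) \<partial>M)
    \<le> integral\<^sup>L M (potential (Suc n))"
proof -
  let ?D = "\<lambda>\<omega>. \<Sum>e\<in>E. (deviation n e \<omega>)\<^sup>2 / total n"
  have "real CARD('v) * real (card E) / total n + (real CARD('v))\<^sup>2 / 2 * integral\<^sup>L M ?D
      = (\<integral>\<omega>. real CARD('v) * real (card E) / total n + (real CARD('v))\<^sup>2 / 2 * ?D \<omega> \<partial>M)"
    by (subst Bochner_Integration.integral_add) (auto simp: prob_space integrable_deviation)
  also have "\<dots> \<le> (\<integral>\<omega>. (\<Sum>e\<in>E. 2 * (1 / edge_balls n e \<omega>)) \<partial>M)"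
    using sum_inverse_edge_balls_ge[of n]
    by (intro integral_mono Bochner_Integration.integrable_sum Bochner_Integration.integrable_add
        integrable_mult_right integrable_inverse_edge_balls integrable_deviation) auto
  also have "\<dots> = (\<Sum>e\<in>E. \<integral>\<omega>. 2 * (1 / edge_balls n e \<omega>) \<partial>M)"
    by (intro Bochner_Integration.integral_sum integrable_mult_right integrable_inverse_edge_balls)
  also have "\<dots> = (\<Sum>e\<in>E. \<integral>\<omega>. 1 / real (cnt n (C n e \<omega>) \<omega>) \<partial>M)"
    by (intro sum.cong) (simp_all add: integral_inverse_chosen)
  also have "\<dots> = (\<integral>\<omega>. (\<Sum>e\<in>E. 1 / real (cnt n (C n e \<omega>) \<omega>)) \<partial>M)"
    by (intro Bochner_Integration.integral_sum[symmetric] integral_inverse_chosen)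
  also have "\<dots> \<le> (\<integral>\<omega>. potential (Suc n) \<omega> - potential n \<omega> \<partial>M)"
    using potential_step
    by (intro integral_mono Bochner_Integration.integrable_sum Bochner_Integration.integrable_diff
        integral_inverse_chosen integrable_potential) (auto simp: algebra_simps)
  also have "\<dots> = integral\<^sup>L M (potential (Suc n)) - integral\<^sup>L M (potential n)"
    by (intro Bochner_Integration.integral_diff integrable_potential)
  finally show ?thesis by simp
qed

section \<open>Almost sure convergence of the edge deviations\<close>

lemma AE_deviation_tendsto: "AE \<omega> in M. \<forall>e\<in>E. (\<lambda>n. deviation n e \<omega>) \<longlonglongrightarrow> 0"
proof -
  define D where "D n \<omega> = (\<Sum>e\<in>E. (deviation n e \<omega>)\<^sup>2 / total n)" for n \<omega>
  define m where "m = real CARD('v)"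
  have m: "m \<ge> 2" using two_le_CARD by (simp add: m_def)
  have D_nonneg: "0 \<le> D n \<omega>" for n \<omega>
    using total_ge[of n] by (simp add: D_def sum_nonneg)
  \<comment> \<open>Telescope the expected increments, starting from a nonnegative
    potential.\<close>
  have sum_D: "m * (\<Sum>k<n. real (card E) / total k) + m\<^sup>2 / 2 * (\<Sum>k<n. integral\<^sup>L M (D k))
      \<le> integral\<^sup>L M (potential n)" for n
  proof (induction n)
    case (Suc n)
    then show ?case
      using integral_potential_step[of n] by (simp add: D_def m_def algebra_simps)
  qed (simp add: potential_nonneg)
  \<comment> \<open>What remains of the upper bound for the potential, uniformly in
    \<open>n\<close>, once the sum of the \<open>N / T\<close> has cancelled on both sides.\<close>
  define K where "K = m * (real d + 1 + ln (total 0))"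
  have "(\<Sum>k<n. integral\<^sup>L M (D k)) \<le> K" for n
  proof -
    have "integral\<^sup>L M (potential n) \<le> (\<integral>\<omega>. m * (real d + 1 + ln (total n)) \<partial>M)"
      using potential_le_ln[of n] by (intro integral_mono integrable_potential) (auto simp: m_def)
    also have "\<dots> = m * (real d + 1 + ln (total n))"
      by (simp add: prob_space)
    also have "\<dots> \<le> m * (real d + 1 + (ln (total 0) + (\<Sum>k<n. real (card E) / total k)))"
      using ln_total_le[of n] m by (intro mult_left_mono) auto
    finally have "m\<^sup>2 / 2 * (\<Sum>k<n. integral\<^sup>L M (D k)) \<le> K"
      using sum_D[of n] by (simp add: K_def algebra_simps)
    \<comment> \<open>Since \<open>m \<ge> 2\<close>, the factor \<open>m\<^sup>2 / 2\<close>
      exceeds 1 and may be dropped.\<close>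
    moreover have "1 * (\<Sum>k<n. integral\<^sup>L M (D k)) \<le> m\<^sup>2 / 2 * (\<Sum>k<n. integral\<^sup>L M (D k))"
      using m power_mono[of 2 m 2]
      by (intro mult_right_mono sum_nonneg integral_nonneg_AE) (auto simp: D_nonneg)
    ultimately show ?thesis by simp
  qed
  moreover have "integrable M (D n)" for n
    unfolding D_def by (intro Bochner_Integration.integrable_sum integrable_deviation)
  ultimately have "AE \<omega> in M. summable (\<lambda>n. D n \<omega>)"
    using D_nonneg by (intro AE_summable_if_integrals_bounded)
  then show ?thesis
  proof eventually_elim
    case (elim \<omega>)
    show ?case
    proof
      fix e assume "e \<in> E"
      have "norm ((deviation n e \<omega>)\<^sup>2 / total n) \<le> D n \<omega>" for n
        using total_ge[of n] member_le_sum[OF \<open>e \<in> E\<close>, of "\<lambda>e. (deviation n e \<omega>)\<^sup>2 / total n"]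
        by (simp add: D_def)
      then have "summable (\<lambda>n. (deviation n e \<omega>)\<^sup>2 / total n)"
        by (rule summable_comparison_test'[where N = 0, OF elim])
      then show "(\<lambda>n. deviation n e \<omega>) \<longlonglongrightarrow> 0"
        by (rule deviation_summable_imp_tendsto)
    qed
  qed
qed

section \<open>Proportions in the simplex and points of \<open>Omega\<close> near them\<close>

lemma proportions_nth: "proportions E B\<^sub>0 C n \<omega> $ i = real (cnt n i \<omega>) / total n"
  by (simp add: proportions_def total_def)

lemma deviation_pair:
  assumes "{i, j} \<in> E"
  shows "deviation n {i, j} \<omega> = (proportions E B\<^sub>0 C n \<omega> $ i - 1 / real CARD('v))
    + (proportions E B\<^sub>0 C n \<omega> $ j - 1 / real CARD('v))"
proof -
  have "i \<noteq> j" using simple assms by (auto simp: simple_graph_def)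
  then show ?thesis
    by (simp add: deviation_def edge_balls_pair proportions_nth add_divide_distrib)
qed

lemma proportions_simplex: "proportions E B\<^sub>0 C n \<omega> \<in> prob_simplex"
  using total_ge[of n]
  by (simp add: prob_simplex_def proportions_nth sum_ball flip: sum_divide_distrib)

text \<open>Each edge has exactly one endpoint in \<open>A\<close>, so double counting gives
  \<open>N = d |A|\<close>; compare with \<open>handshake\<close> and cancel
  \<open>d\<close>.\<close>

lemma bipartition_card:
  assumes bip: "bipartition E A B"
  shows "2 * card A = CARD('v)" and "2 * card B = CARD('v)"
proof -
  have half: "2 * card A = CARD('v)" if "bipartition E A B" for A B
  proof -
    have "(\<Sum>i\<in>e. if i \<in> A then 1 else 0 :: real) = 1" if "e \<in> E" for e
    proof -
      obtain a b where "a \<in> A" "b \<in> B" "e = {a, b}" "A \<inter> B = {}"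
        using \<open>bipartition E A B\<close> \<open>e \<in> E\<close> unfolding bipartition_def by blast
      moreover from this have "a \<noteq> b" "b \<notin> A" by auto
      ultimately show ?thesis by simp
    qed
    then have "real (card E) = real d * real (card A)"
      using sum_edges_swap[of "\<lambda>i. if i \<in> A then 1 else 0"] by (simp add: sum.If_cases)
    with handshake have "real d * real (2 * card A) = real d * real CARD('v)" by simp
    then show ?thesis using d_pos by simp
  qed
  show "2 * card A = CARD('v)" using half[OF bip] .
  show "2 * card B = CARD('v)"
  proof (rule half)
    show "bipartition E B A" using bip by (fastforce simp: bipartition_def)
  qed
qed

end

text \<open>An explicit point of \<open>Omega\<close> that bounds the distance from
  \<open>x\<close>: averaging over each side keeps the mass of that side.\<close>

definition side_average :: "'v::finite set \<Rightarrow> 'v set \<Rightarrow> real ^ 'v \<Rightarrow> real ^ 'v" where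
  "side_average A B x =
    (\<chi> i. if i \<in> A then (\<Sum>j\<in>A. x $ j) / real (card A) else (\<Sum>j\<in>B. x $ j) / real (card B))"

text \<open>Both sides have \<open>m / 2\<close> vertices, so the two averages add up to the total
  mass 1 divided by \<open>m / 2\<close>.\<close>

lemma side_average_in_Omega:
  fixes A B :: "'v::finite set"
  assumes x: "x \<in> prob_simplex" and un: "A \<union> B = UNIV" and disj: "A \<inter> B = {}"
    and card: "2 * card A = CARD('v)" "2 * card B = CARD('v)"
  shows "side_average A B x \<in> Omega A B"
proof -
  define p where "p = (\<Sum>j\<in>A. x $ j) / real (card A)"
  define q where "q = (\<Sum>j\<in>B. x $ j) / real (card B)"
  have pos: "card A > 0" "card B > 0"
    using card by (metis mult_0_right neq0_conv zero_less_card_finite less_irrefl)+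
  have c: "real (card A) = real CARD('v) / 2" "real (card B) = real CARD('v) / 2"
    using card by linarith+
  have "p \<ge> 0" "q \<ge> 0"
    using x by (auto simp: p_def q_def prob_simplex_def sum_nonneg)
  have split: "(\<Sum>i\<in>UNIV. f i) = (\<Sum>i\<in>A. f i) + (\<Sum>i\<in>B. f i)" for f :: "'v \<Rightarrow> real"
    using sum.union_disjoint[of A B f] un disj by simp
  have A: "side_average A B x $ i = p" if "i \<in> A" for i
    using that by (simp add: side_average_def p_def)
  have B: "side_average A B x $ i = q" if "i \<in> B" for i
    using that disj by (auto simp: side_average_def q_def)
  have sum: "(\<Sum>i\<in>A. x $ i) + (\<Sum>i\<in>B. x $ i) = 1"
    using x by (simp add: prob_simplex_def split)
  have "p + q = 2 / real CARD('v)"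
    using sum unfolding p_def q_def c by (simp add: field_simps flip: distrib_left)
  moreover have "(\<Sum>i\<in>UNIV. side_average A B x $ i) = 1"
    using sum pos by (simp add: split A B p_def q_def) (auto simp: card_gt_0_iff)
  moreover have "side_average A B x $ i \<ge> 0" for i
    using \<open>p \<ge> 0\<close> \<open>q \<ge> 0\<close> A[of i] B[of i] un by (cases "i \<in> A") auto
  ultimately show ?thesis
    using A B \<open>p \<ge> 0\<close> \<open>q \<ge> 0\<close> by (auto simp: Omega_def prob_simplex_def)
qed

lemma average_diff:
  fixes f :: "'a \<Rightarrow> real"
  assumes "card S > 0"
  shows "x - (\<Sum>j\<in>S. f j) / real (card S) = (\<Sum>j\<in>S. x - f j) / real (card S)"
  using assms by (simp add: sum_subtractf diff_divide_distrib)

text \<open>A coordinate minus the average of its side is the average of its differences to the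
  coordinates on that side, each of which tends to 0.\<close>

lemma side_average_tendsto:
  fixes x :: "nat \<Rightarrow> real ^ 'v::finite"
  assumes un: "A \<union> B = UNIV"
    and same: "\<And>v w. (v \<in> A \<longleftrightarrow> w \<in> A) \<Longrightarrow> (\<lambda>n. x n $ v - x n $ w) \<longlonglongrightarrow> 0" and disj: "A \<inter> B = {}"
  shows "(\<lambda>n. x n - side_average A B (x n)) \<longlonglongrightarrow> 0"
proof (rule vec_tendstoI)
  fix i
  define S where "S = (if i \<in> A then A else B)"
  have "i \<in> S" using un by (auto simp: S_def)
  then have "card S > 0" by (auto simp: card_gt_0_iff)
  have "(\<lambda>n. (\<Sum>j\<in>S. x n $ i - x n $ j) / real (card S)) \<longlonglongrightarrow> (\<Sum>j\<in>S. 0) / real (card S)"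
    using \<open>i \<in> S\<close> un disj by (intro tendsto_divide tendsto_sum same tendsto_const)
      (auto simp: S_def \<open>card S > 0\<close> split: if_splits)
  moreover have "(x n - side_average A B (x n)) $ i = (\<Sum>j\<in>S. x n $ i - x n $ j) / real (card S)" for n
    unfolding average_diff[OF \<open>card S > 0\<close>, symmetric] by (simp add: side_average_def S_def)
  ultimately show "(\<lambda>n. (x n - side_average A B (x n)) $ i) \<longlonglongrightarrow> 0 $ i"
    by simp
qed

section \<open>Both assertions of the theorem\<close>

lemma no_edges_singleton:
  assumes con: "connected_graph (E :: 'v::finite set set)" and "E = {}"
  shows "(UNIV :: 'v set) = {v}"
  using assms by (auto simp: connected_graph_def)

theorem theorem1p1:
  fixes M :: "'w measure" and E :: "'v::finite set set"
    and B\<^sub>0 :: "'v \<Rightarrow> nat" and C :: "nat \<Rightarrow> 'v set \<Rightarrow> 'w \<Rightarrow> 'v"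
  assumes "simple_graph E" and "connected_graph E" and "regular_graph E"
    and "polya_urn M E 1 B\<^sub>0 C"
  shows "(\<not> bipartite E \<longrightarrow>
            (AE \<omega> in M. (\<lambda>n. proportions E B\<^sub>0 C n \<omega>) \<longlonglongrightarrow> (\<chi> i. 1 / real CARD('v)))) \<and>
         (\<forall>A B. bipartition E A B \<longrightarrow>
            (AE \<omega> in M. (\<lambda>n. infdist (proportions E B\<^sub>0 C n \<omega>) (Omega A B)) \<longlonglongrightarrow> 0))"
proof (cases "E = {}")
  \<comment> \<open>A connected graph without edges is a single vertex. No ball is ever added, and
    the proportions are constantly uniform.\<close>
  case True
  define v where "v = (undefined :: 'v)"
  have univ: "(UNIV :: 'v set) = {v}"
    using assms(2) True by (rule no_edges_singleton)
  then have all: "i = v" for i by blast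
  interpret polya_urn M E 1 B\<^sub>0 C by fact
  have "balls E B\<^sub>0 C n i \<omega> = B\<^sub>0 i" for n i \<omega>
    using True by (induction n) auto
  moreover have "(\<Sum>j\<in>UNIV. B\<^sub>0 j) = B\<^sub>0 v" by (simp add: univ)
  moreover have "real (B\<^sub>0 v) > 0" using initial_pos[of v] by simp
  ultimately have "proportions E B\<^sub>0 C n \<omega> = (\<chi> i. 1 / real CARD('v))" for n \<omega>
    using all True by (simp add: proportions_def vec_eq_iff univ) (metis)
  then show ?thesis
    by (simp add: uniform_in_Omega)
next
  case False
  obtain d where d: "degree E v = d" for v
    using assms(3) by (auto simp: regular_graph_def)
  obtain e v where "e \<in> E" "v \<in> e"
    using False assms(1) by (force simp: simple_graph_def card_2_iff)
  then have "d > 0"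
    using d[of v] by (auto simp: degree_def card_gt_0_iff)
  then interpret regular_urn M E B\<^sub>0 C d
    using assms d by (simp add: regular_urn_def regular_urn_axioms_def)
  let ?x = "proportions E B\<^sub>0 C"
  \<comment> \<open>Centred at \<open>1 / m\<close>, the coordinates of the two endpoints sum to the
    deviation of the edge, so the lemmas on vanishing edge sums apply path by path.\<close>
  let ?u = "\<lambda>\<omega> n i. ?x n \<omega> $ i - 1 / real CARD('v)"
  have edge: "AE \<omega> in M. \<forall>i j. {i, j} \<in> E \<longrightarrow> (\<lambda>n. ?u \<omega> n i + ?u \<omega> n j) \<longlonglongrightarrow> 0"
    using AE_deviation_tendsto
  proof eventually_elim
    case (elim \<omega>)
    then show ?case by (auto simp flip: deviation_pair)
  qed
  have "AE \<omega> in M. (\<lambda>n. ?x n \<omega>) \<longlonglongrightarrow> (\<chi> i. 1 / real CARD('v))" if "\<not> bipartite E"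
    using edge
  proof eventually_elim
    case (elim \<omega>)
    have "(\<lambda>n. ?u \<omega> n i) \<longlonglongrightarrow> 0" for i
      by (rule edge_sums_tendsto_zero_nonbipartite[OF assms(1,2) that]) (use elim in blast)
    then show ?case
      by (intro vec_tendstoI) (simp add: LIM_zero_iff)
  qed
  moreover have "AE \<omega> in M. (\<lambda>n. infdist (?x n \<omega>) (Omega A B)) \<longlonglongrightarrow> 0" if bip: "bipartition E A B" for A B
    using edge
  proof eventually_elim
    case (elim \<omega>)
    have AB: "A \<union> B = UNIV" "A \<inter> B = {}"
      using bip by (auto simp: bipartition_def)
    have "(\<lambda>n. ?u \<omega> n v - ?u \<omega> n w) \<longlonglongrightarrow> 0" if "v \<in> A \<longleftrightarrow> w \<in> A" for v w
      by (rule edge_sums_tendsto_zero_bipartite[OF assms(2) bip _ that]) (use elim in blast)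
    then have "(\<lambda>n. ?x n \<omega> - side_average A B (?x n \<omega>)) \<longlonglongrightarrow> 0"
      using AB by (intro side_average_tendsto) simp_all
    then have dist: "(\<lambda>n. dist (?x n \<omega>) (side_average A B (?x n \<omega>))) \<longlonglongrightarrow> 0"
      by (simp add: dist_norm tendsto_norm_zero_iff)
    have "infdist (?x n \<omega>) (Omega A B) \<le> dist (?x n \<omega>) (side_average A B (?x n \<omega>))" for n
      by (intro infdist_le side_average_in_Omega proportions_simplex AB bipartition_card[OF bip])
    then show ?case
      by (intro tendsto_sandwich[OF _ _ tendsto_const dist]) (auto simp: infdist_nonneg)
  qed
  ultimately show ?thesis by blast
qed

end
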